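(* Let $p\in\mathbb{C}$ and $\nu\ge0$ be such that either $\Re(p)>0$, or $p=\nu=0$. Let $z\in\mathbb{C}\setminus\{0\}$ with $-\pi<\arg z\le\pi$, and let $\kappa,\mu\in\mathbb{C}$ with $2\mu\notin\{-1,-2,\ldots\}$ and $\mu\pm\kappa+\frac12\notin\{0,-1,-2,\ldots\}$. Then for $n=0,1,2,\ldots$ $$\frac{d^n}{dz^n}\left\{z^{-\mu-\frac12}e^{z/2}M_{\kappa,\mu}^{(p,\nu)}(z)\right\}=\frac{(\mu-\kappa+\frac12)_n}{(2\mu+1)_n}\,z^{-\mu-\frac12-\frac n2}\,e^{z/2}\,M_{\kappa-\frac12n,\;\mu+\frac12n}^{(p,\nu)}(z).$$
   Context: $(a)_n=\Gamma(a+n)/\Gamma(a)$ is the Pochhammer symbol, $B(x,y)=\Gamma(x)\Gamma(y)/\Gamma(x+y)$ is the Beta function ($x,y\ne 0,-1,-2,\ldots$), and $K_\lambda$ is the modified Bessel function of the second kind. Complex powers of $z$ are principal. For $\Re(p)>0$, $\nu\ge 0$, the extended Beta function is $$B_{p,\nu}(x,y)=\sqrt{\frac{2p}{\pi}}\int_0^1 t^{x-\frac32}(1-t)^{y-\frac32}K_{\nu+\frac12}\left(\frac{p}{t(1-t)}\right)dt.$$ The $(p,\nu)$-extended confluent hypergeometric function is $$\Phi_{p,\nu}(b;c;z)=\sum_{m=0}^\infty\frac{B_{p,\nu}(b+m,c-b)}{B(b,c-b)}\frac{z^m}{m!}=\frac{1}{B(b,c-b)}\sqrt{\frac{2p}{\pi}}\int_0^1t^{b-\frac32}(1-t)^{c-b-\frac32}e^{zt}K_{\nu+\frac12}\left(\frac{p}{t(1-t)}\right)dt,$$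 and for $p=\nu=0$ it is the ordinary confluent hypergeometric function $\Phi_{0,0}(b;c;z)=\sum_{m\ge0}\frac{(b)_m}{(c)_m}\frac{z^m}{m!}$. The $(p,\nu)$-extended Whittaker function is $$M_{\kappa,\mu}^{(p,\nu)}(z)=z^{\mu+\frac12}e^{-z/2}\,\Phi_{p,\nu}(\mu-\kappa+\tfrac12;2\mu+1;z).$$ *)

theory Defs
  imports "HOL-Complex_Analysis.Complex_Analysis"
begin

(* Modified Bessel function of the second kind, K_lam(w), by its classical integral
   (DLMF 10.32.9).  The integral converges absolutely, for every order lam, when Re w > 0;
   for other w the value is meaningless.  Below, w = p / (t (1 - t)) with Re p > 0 and
   0 < t < 1, so Re w > 0. *)
definition Bessel_K :: "complex \<Rightarrow> complex \<Rightarrow> complex" where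
  "Bessel_K lam w =
     (LINT t:{0<..}|lborel. exp (- w * of_real (cosh t)) * cosh (lam * of_real t))"

definition ext_Beta :: "complex \<Rightarrow> real \<Rightarrow> complex \<Rightarrow> complex \<Rightarrow> complex" where
  "ext_Beta p \<nu> x y = csqrt (2 * p / of_real pi) *
     (LINT t:{0<..<1}|lborel.
        of_real t powr (x - 3/2) * of_real (1 - t) powr (y - 3/2) *
        Bessel_K (of_real (\<nu> + 1/2)) (p / of_real (t * (1 - t))))"

(* For p = nu = 0 the integral for ext_Beta is not available, and the function is by convention
   the ordinary confluent hypergeometric function.  The case p = 0 < nu is not used. *)
definition ext_Phi :: "complex \<Rightarrow> real \<Rightarrow> complex \<Rightarrow> complex \<Rightarrow> complex \<Rightarrow> complex" where
  "ext_Phi p \<nu> b c z =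
     (if p = 0 \<and> \<nu> = 0
      then (\<Sum>m. pochhammer b m / pochhammer c m * z ^ m / fact m)
      else (\<Sum>m. ext_Beta p \<nu> (b + of_nat m) (c - b) / Beta b (c - b) * z ^ m / fact m))"

definition ext_Whittaker_M ::
    "complex \<Rightarrow> real \<Rightarrow> complex \<Rightarrow> complex \<Rightarrow> complex \<Rightarrow> complex" where
  "ext_Whittaker_M p \<nu> \<kappa> \<mu> z =
     z powr (\<mu> + 1/2) * exp (- z / 2) * ext_Phi p \<nu> (\<mu> - \<kappa> + 1/2) (2 * \<mu> + 1) z"

end

theory Submission
  imports Defs
begin

text \<open>
  Away from the origin the powers of \<open>w\<close> and the exponentials cancel, so the differentiated
  function is \<open>\<Phi>(b; c; w)\<close>, an exponential generating function \<open>\<Sum>m. a m * w^m / m!\<close>.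
  Differentiating \<open>n\<close> times shifts the coefficients by \<open>n\<close>, and
  \<open>B(b + n, c - b) = B(b, c - b) (b)\<^sub>n / (c)\<^sub>n\<close> turns the shift of \<open>a\<close> into the shift of the
  parameters. Convergence needs no estimate of the Bessel function: on the unit interval the
  integrand of the extended Beta function is only damped by the extra factor \<open>t^m\<close>.
\<close>

section \<open>Exponential generating functions with geometrically bounded coefficients\<close>

text \<open>Comparison with the series of \<open>C * exp (K * norm z)\<close>. A geometric bound
  suits both kinds of coefficients below and survives index shifts.\<close>

lemma egf_summable:
  fixes a :: "nat \<Rightarrow> complex"
  assumes "\<And>m. norm (a m) \<le> C * K ^ m"
  shows "summable (\<lambda>m. a m / fact m * z ^ m)"
proof (rule summable_comparison_test')
  show "summable (\<lambda>m. C * (inverse (fact m) * (K * norm z) ^ m))"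
    by (intro summable_mult summable_exp)
  show "norm (a m / fact m * z ^ m) \<le> C * (inverse (fact m) * (K * norm z) ^ m)" for m
    using mult_right_mono[OF assms[of m], of "inverse (fact m) * norm z ^ m"]
    by (simp add: norm_mult norm_divide norm_power power_mult_distrib divide_simps mult_ac)
qed

text \<open>The factor \<open>m + 1\<close> from termwise differentiation cancels against
  \<open>(m + 1)!\<close>, so only the index of \<open>a\<close> moves.\<close>

lemma egf_has_field_derivative:
  fixes a :: "nat \<Rightarrow> complex"
  assumes "\<And>m. norm (a m) \<le> C * K ^ m"
  shows "((\<lambda>z. \<Sum>m. a m * z ^ m / fact m) has_field_derivative
           (\<Sum>m. a (Suc m) * z ^ m / fact m)) (at z)"
proof -
  have "diffs (\<lambda>m. a m / fact m) = (\<lambda>m. a (Suc m) / fact m)"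
    by (rule ext) (simp add: diffs_def divide_simps del: of_nat_Suc)
  then show ?thesis
    using termdiffs_strong_converges_everywhere[OF egf_summable[OF assms], of z] by simp
qed

lemma egf_higher_deriv:
  fixes a :: "nat \<Rightarrow> complex"
  assumes "\<And>m. norm (a m) \<le> C * K ^ m"
  shows "(deriv ^^ n) (\<lambda>z. \<Sum>m. a m * z ^ m / fact m) = (\<lambda>z. \<Sum>m. a (m + n) * z ^ m / fact m)"
proof (induction n)
  case (Suc n)
  \<comment> \<open>The shifted sequence keeps the ratio \<open>K\<close>; the constant absorbs
    \<open>K ^ n\<close>.\<close>
  have "norm (a (m + n)) \<le> (C * K ^ n) * K ^ m" for m
    using assms[of "m + n"] by (simp add: power_add mult_ac)
  from DERIV_imp_deriv[OF egf_has_field_derivative[OF this]] Suc show ?case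
    by simp
qed simp

section \<open>Growth of the coefficients\<close>

text \<open>The quotient is a product of \<open>m\<close> factors \<open>(b + j) / (c + j)\<close>.
  These tend to 1, hence are bounded by a common \<open>K\<close>.\<close>

lemma norm_pochhammer_quotient_le:
  fixes b c :: complex
  assumes "c \<notin> \<int>\<^sub>\<le>\<^sub>0"
  obtains K where "\<And>m. norm (pochhammer b m / pochhammer c m) \<le> K ^ m"
proof -
  have "(\<lambda>m. (b + of_nat m) / (c + of_nat m)) \<longlonglongrightarrow> 1"
  proof (rule Lim_transform_eventually)
    have "(\<lambda>m. 1 + (b - c) / (c + of_nat m)) \<longlonglongrightarrow> 1 + 0"
      by (intro tendsto_add tendsto_const tendsto_divide_0[OF tendsto_const]
          tendsto_add_filterlim_at_infinity[OF tendsto_const] tendsto_of_nat)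
    then show "(\<lambda>m. 1 + (b - c) / (c + of_nat m)) \<longlonglongrightarrow> 1" by simp
    have "c + of_nat m \<noteq> 0" for m
      using assms by (auto simp flip: eq_neg_iff_add_eq_0)
    then show "\<forall>\<^sub>F m in sequentially. 1 + (b - c) / (c + of_nat m) = (b + of_nat m) / (c + of_nat m)"
      by (simp add: divide_simps)
  qed
  then have "Bseq (\<lambda>m. (b + of_nat m) / (c + of_nat m))"
    by (intro convergent_imp_Bseq convergentI)
  then obtain K where K: "\<And>m. norm ((b + of_nat m) / (c + of_nat m)) \<le> K"
    by (elim BseqE) blast
  have "norm (pochhammer b m / pochhammer c m) \<le> K ^ m" for m
  proof (induction m)
    case (Suc m)
    have "norm (pochhammer b m / pochhammer c m) * norm ((b + of_nat m) / (c + of_nat m)) \<le> K ^ m * K"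
      using Suc K order_trans[OF norm_ge_zero Suc] by (intro mult_mono) auto
    then show ?case
      by (simp add: pochhammer_Suc norm_mult norm_divide mult_ac)
  qed simp
  then show thesis by (rule that)
qed

text \<open>If no integrand is integrable, then all the integrals are \<open>0\<close> by convention; otherwise
  the first integrable one dominates those after it. Hence no integrability is needed.\<close>

lemma norm_moments_le:
  fixes g :: "real \<Rightarrow> complex"
  obtains C where "\<And>m. norm (LINT t:{0<..<1}|lborel. of_real t ^ m * g t) \<le> C"
proof -
  define I where "I = (\<lambda>m. LINT t:{0<..<1}|lborel. of_real t ^ m * g t)"
  define int where
    "int = (\<lambda>m. set_integrable lborel {0<..<1} (\<lambda>t. of_real t ^ m * g t))"
  have zero: "I m = 0" if "\<not> int m" for m
    using that by (simp add: I_def int_def set_lebesgue_integral_def set_integrable_def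
        not_integrable_integral_eq)
  show thesis
  proof (cases "\<exists>m. int m")
    case False
    then show thesis using zero that[of 0] by (simp add: I_def)
  next
    case True
    define m0 where "m0 = (LEAST m. int m)"
    have m0: "int m0" using True unfolding m0_def by (metis LeastI)
    define D where "D = (LINT t:{0<..<1}|lborel. norm (of_real t ^ m0 * g t))"
    have D_int: "set_integrable lborel {0<..<1} (\<lambda>t. norm (of_real t ^ m0 * g t))"
      using m0 by (auto simp: int_def intro: set_integrable_norm)
    have "D \<ge> 0"
      unfolding D_def set_lebesgue_integral_def by (intro integral_nonneg_AE) auto
    have "norm (I m) \<le> D" for m
    proof (cases "int m")
      case False
      then show ?thesis using zero \<open>D \<ge> 0\<close> by simp
    next
      case True
      then have "m0 \<le> m" unfolding m0_def by (rule Least_le)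
      have "norm (I m) \<le> (LINT t:{0<..<1}|lborel. norm (of_real t ^ m * g t))"
        unfolding I_def using True by (intro set_integral_norm_bound) (simp add: int_def)
      also have "\<dots> \<le> D"
        unfolding D_def
      proof (rule set_integral_mono[OF _ D_int])
        show "set_integrable lborel {0<..<1} (\<lambda>t. norm (of_real t ^ m * g t))"
          using True by (auto simp: int_def intro: set_integrable_norm)
        show "norm (of_real t ^ m * g t) \<le> norm (of_real t ^ m0 * g t)" if "t \<in> {0<..<1}" for t
          using that \<open>m0 \<le> m\<close>
          by (auto simp: norm_mult norm_power intro!: mult_right_mono power_decreasing)
      qed
      finally show ?thesis .
    qed
    then show thesis using that unfolding I_def by blast
  qed
qed

text \<open>Raising \<open>x\<close> by \<open>m\<close> multiplies the integrand by
  \<open>t ^ m\<close>, so these values are, up to a constant factor, the moments of one fixed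
  function.\<close>

lemma norm_ext_Beta_le:
  obtains C where "\<And>m. norm (ext_Beta p \<nu> (x + of_nat m) y) \<le> C"
proof -
  define g where "g = (\<lambda>t::real. of_real t powr (x - 3/2) * of_real (1 - t) powr (y - 3/2) *
        Bessel_K (of_real (\<nu> + 1/2)) (p / of_real (t * (1 - t))))"
  obtain C where C: "\<And>m. norm (LINT t:{0<..<1}|lborel. of_real t ^ m * g t) \<le> C"
    using norm_moments_le by blast
  have "ext_Beta p \<nu> (x + of_nat m) y =
          csqrt (2 * p / of_real pi) * (LINT t:{0<..<1}|lborel. of_real t ^ m * g t)" for m
  proof -
    \<comment> \<open>Here \<open>t\<close> must be nonzero: for \<open>m = 0\<close> the complex
      \<open>0 powr 0\<close> is 0, but \<open>0 ^ 0\<close> is 1.\<close>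
    have t_powr: "of_real t powr (x + of_nat m - 3/2) = of_real t ^ m * of_real t powr (x - 3/2)"
      if "t \<in> {0<..<1}" for t :: real
    proof -
      have "of_real t powr (x + of_nat m - 3/2) = of_real t powr (of_nat m + (x - 3/2))"
        by (simp add: algebra_simps)
      then show ?thesis using that by (simp add: powr_add powr_nat' del: of_real_power)
    qed
    show ?thesis
      unfolding ext_Beta_def g_def
      by (intro arg_cong2[where f = "(*)"] set_lebesgue_integral_cong refl)
        (simp_all add: t_powr mult_ac)
  qed
  then show thesis
    using that[of "norm (csqrt (2 * p / of_real pi)) * C"] C
    by (simp add: norm_mult mult_left_mono)
qed

section \<open>Coefficients and derivatives of the extended confluent hypergeometric
  function\<close>

text \<open>The case distinction moves inside the sum, so that one generating function covers both
  cases of \<open>ext_Phi\<close>.\<close>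

definition ext_Phi_coeff :: "complex \<Rightarrow> real \<Rightarrow> complex \<Rightarrow> complex \<Rightarrow> nat \<Rightarrow> complex" where
  "ext_Phi_coeff p \<nu> b c m =
     (if p = 0 \<and> \<nu> = 0 then pochhammer b m / pochhammer c m
      else ext_Beta p \<nu> (b + of_nat m) (c - b) / Beta b (c - b))"

lemma ext_Phi_egf: "ext_Phi p \<nu> b c = (\<lambda>z. \<Sum>m. ext_Phi_coeff p \<nu> b c m * z ^ m / fact m)"
proof (cases "p = 0 \<and> \<nu> = 0")
  case True
  show ?thesis unfolding fun_eq_iff ext_Phi_def ext_Phi_coeff_def if_P[OF True] by blast
next
  case False
  show ?thesis unfolding fun_eq_iff ext_Phi_def ext_Phi_coeff_def if_not_P[OF False] by blast
qed

lemma norm_ext_Phi_coeff_le: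
  assumes "c \<notin> \<int>\<^sub>\<le>\<^sub>0"
  obtains C K where "\<And>m. norm (ext_Phi_coeff p \<nu> b c m) \<le> C * K ^ m"
proof (cases "p = 0 \<and> \<nu> = 0")
  case True
  then show thesis
    using norm_pochhammer_quotient_le[OF assms, of b] that[of 1]
    by (auto simp: ext_Phi_coeff_def)
next
  case False
  obtain C where "\<And>m. norm (ext_Beta p \<nu> (b + of_nat m) (c - b)) \<le> C"
    using norm_ext_Beta_le by blast
  then have "norm (ext_Phi_coeff p \<nu> b c m) \<le> C / norm (Beta b (c - b)) * 1 ^ m" for m
    using False by (auto simp: ext_Phi_coeff_def norm_divide intro!: divide_right_mono)
  then show thesis by (rule that)
qed

text \<open>Apply \<open>Gamma (w + n) = pochhammer w n * Gamma w\<close> at \<open>w = x\<close>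
  and at \<open>w = x + y\<close>; the factor \<open>Gamma y\<close> is unaffected.\<close>

lemma Beta_plus_of_nat_left:
  fixes x y :: complex
  assumes "x \<notin> \<int>\<^sub>\<le>\<^sub>0" "x + y \<notin> \<int>\<^sub>\<le>\<^sub>0"
  shows "Beta (x + of_nat n) y = pochhammer x n / pochhammer (x + y) n * Beta x y"
  using assms by (simp add: Beta_def pochhammer_Gamma Gamma_eq_zero_iff add_ac)

text \<open>For \<open>p = \<nu> = 0\<close> this splits Pochhammer symbols. Otherwise
  \<open>c - b\<close> is invariant under the joint shift, so the \<open>ext_Beta\<close> numerators
  agree and only the normalising \<open>Beta\<close> changes.\<close>

lemma ext_Phi_coeff_add:
  assumes "b \<notin> \<int>\<^sub>\<le>\<^sub>0" "c \<notin> \<int>\<^sub>\<le>\<^sub>0"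
  shows "ext_Phi_coeff p \<nu> b c (m + n) =
    pochhammer b n / pochhammer c n * ext_Phi_coeff p \<nu> (b + of_nat n) (c + of_nat n) m"
proof (cases "p = 0 \<and> \<nu> = 0")
  case True
  then show ?thesis
    using pochhammer_product'[of b n m] pochhammer_product'[of c n m]
    by (simp add: ext_Phi_coeff_def add.commute)
next
  case False
  \<comment> \<open>The Pochhammer quotient occurs as prefactor and inside the shifted
    \<open>Beta\<close> in the denominator; being nonzero, it cancels.\<close>
  have "pochhammer b n \<noteq> 0" "pochhammer c n \<noteq> 0"
    using assms by (auto simp: pochhammer_eq_0_iff)
  moreover have "ext_Phi_coeff p \<nu> x y =
      (\<lambda>m. ext_Beta p \<nu> (x + of_nat m) (y - x) / Beta x (y - x))" for x y
    using False by (auto simp: ext_Phi_coeff_def)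
  ultimately show ?thesis
    using Beta_plus_of_nat_left[of b "c - b" n] assms by (simp add: add_ac)
qed

text \<open>As \<open>deriv\<close> is total, an equation between derivatives does not show that
  they exist; analyticity does.\<close>

lemma ext_Phi_analytic:
  assumes "c \<notin> \<int>\<^sub>\<le>\<^sub>0"
  shows "ext_Phi p \<nu> b c analytic_on S"
proof -
  obtain C K where "\<And>m. norm (ext_Phi_coeff p \<nu> b c m) \<le> C * K ^ m"
    using norm_ext_Phi_coeff_le[OF assms] by blast
  from egf_has_field_derivative[OF this] have "ext_Phi p \<nu> b c holomorphic_on UNIV"
    by (auto simp: ext_Phi_egf holomorphic_on_open)
  then show ?thesis
    using analytic_on_open analytic_on_subset by blast
qed

lemma ext_Phi_higher_deriv:
  assumes "b \<notin> \<int>\<^sub>\<le>\<^sub>0" "c \<notin> \<int>\<^sub>\<le>\<^sub>0"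
  shows "(deriv ^^ n) (ext_Phi p \<nu> b c) z =
    pochhammer b n / pochhammer c n * ext_Phi p \<nu> (b + of_nat n) (c + of_nat n) z"
proof -
  define a where "a = ext_Phi_coeff p \<nu> (b + of_nat n) (c + of_nat n)"
  have "c + of_nat n \<notin> \<int>\<^sub>\<le>\<^sub>0"
    using assms(2) nonpos_Ints_diff_Nats[of "c + of_nat n" "of_nat n"] by auto
  then obtain C' K' where "\<And>m. norm (a m) \<le> C' * K' ^ m"
    unfolding a_def using norm_ext_Phi_coeff_le by blast
  \<comment> \<open>Convergence is what allows the constant factor to be pulled out of the
    sum.\<close>
  then have a: "summable (\<lambda>m. a m * z ^ m / fact m)"
    using egf_summable[of a C' K' z] by simp
  obtain C K where "\<And>m. norm (ext_Phi_coeff p \<nu> b c m) \<le> C * K ^ m"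
    using norm_ext_Phi_coeff_le[OF assms(2)] by blast
  from egf_higher_deriv[OF this]
  have "(deriv ^^ n) (ext_Phi p \<nu> b c) z =
      (\<Sum>m. pochhammer b n / pochhammer c n * (a m * z ^ m / fact m))"
    by (simp add: ext_Phi_egf ext_Phi_coeff_add[OF assms] a_def mult.assoc)
  then show ?thesis
    unfolding suminf_mult[OF a] by (simp only: ext_Phi_egf a_def)
qed

section \<open>Transfer to the Whittaker function\<close>

text \<open>Both powers use the same principal logarithm of \<open>z\<close>, so they cancel on the
  branch cut too.\<close>

lemma ext_Whittaker_M_cancel:
  assumes "z \<noteq> 0"
  shows "z powr (- \<mu> - 1/2) * exp (z / 2) * ext_Whittaker_M p \<nu> \<kappa> \<mu> z =
    ext_Phi p \<nu> (\<mu> - \<kappa> + 1/2) (2 * \<mu> + 1) z"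
proof -
  have "z powr (- \<mu> - 1/2) * z powr (\<mu> + 1/2) = 1"
    using assms by (simp flip: powr_add)
  moreover have "exp (z / 2) * exp (- z / 2) = 1"
    by (simp flip: exp_add)
  moreover have "s * e * (s' * e' * u) = (s * s') * (e * e') * u" for s s' e e' u :: complex
    by simp
  ultimately show ?thesis
    unfolding ext_Whittaker_M_def by (simp only: mult_1)
qed

theorem mainTheorem8:
  fixes p z \<kappa> \<mu> :: complex and \<nu> :: real and n :: nat
  assumes "\<nu> \<ge> 0"
    and "Re p > 0 \<or> p = 0 \<and> \<nu> = 0"
    and "z \<noteq> 0"
    and "2 * \<mu> \<notin> \<int>\<^sub>\<le>\<^sub>0 - {0}"
    and "\<mu> + \<kappa> + 1/2 \<notin> \<int>\<^sub>\<le>\<^sub>0"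
    and "\<mu> - \<kappa> + 1/2 \<notin> \<int>\<^sub>\<le>\<^sub>0"
  defines "f \<equiv> (\<lambda>w. w powr (- \<mu> - 1/2) * exp (w / 2) * ext_Whittaker_M p \<nu> \<kappa> \<mu> w)"
  shows "f analytic_on {z} \<and>
    (deriv ^^ n) f z =
      pochhammer (\<mu> - \<kappa> + 1/2) n / pochhammer (2 * \<mu> + 1) n *
      z powr (- \<mu> - 1/2 - of_nat n / 2) * exp (z / 2) *
      ext_Whittaker_M p \<nu> (\<kappa> - of_nat n / 2) (\<mu> + of_nat n / 2) z"
proof -
  define b c where "b = \<mu> - \<kappa> + 1/2" and "c = 2 * \<mu> + 1"
  \<comment> \<open>If \<open>c = -k\<close> then \<open>2 * \<mu> = -(k + 1)\<close>, a negative
    integer. The value \<open>2 * \<mu> = 0\<close> is allowed and gives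
    \<open>c = 1\<close>.\<close>
  have c: "c \<notin> \<int>\<^sub>\<le>\<^sub>0"
  proof
    assume "c \<in> \<int>\<^sub>\<le>\<^sub>0"
    then obtain k where "2 * \<mu> + 1 = - of_nat k"
      unfolding c_def by (auto elim: nonpos_Ints_cases')
    then have "2 * \<mu> = - of_nat k - 1"
      by (simp only: eq_diff_eq)
    then have "2 * \<mu> = - of_nat (Suc k)"
      by simp
    then have "2 * \<mu> \<in> \<int>\<^sub>\<le>\<^sub>0 - {0}"
      by (metis Diff_iff empty_iff insert_iff neg_equal_0_iff_equal minus_of_nat_in_nonpos_Ints
          of_nat_neq_0)
    with assms(4) show False by contradiction
  qed
  have b: "b \<notin> \<int>\<^sub>\<le>\<^sub>0" using assms(6) by (simp add: b_def)
  \<comment> \<open>The cancellation may fail at 0, where \<open>f\<close> vanishes. Agreement near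
    \<open>z\<close> suffices, as analyticity and derivatives are local.\<close>
  have "\<forall>\<^sub>F w in nhds z. w \<noteq> 0"
    using \<open>z \<noteq> 0\<close> by (rule t1_space_nhds)
  then have ev: "\<forall>\<^sub>F w in nhds z. f w = ext_Phi p \<nu> b c w"
    by eventually_elim (simp add: f_def b_def c_def ext_Whittaker_M_cancel)
  have "f analytic_on {z}"
    using analytic_at_cong[OF ev refl] ext_Phi_analytic[OF c] by blast
  moreover have "(deriv ^^ n) f z =
      pochhammer b n / pochhammer c n * ext_Phi p \<nu> (b + of_nat n) (c + of_nat n) z"
    using higher_deriv_cong_ev[OF ev refl] ext_Phi_higher_deriv[OF b c] by simp
  \<comment> \<open>The half shifts of \<open>\<kappa>\<close> and \<open>\<mu>\<close> are those
    that raise both \<open>\<mu> - \<kappa> + 1/2\<close> and \<open>2 * \<mu> + 1\<close> by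
    \<open>n\<close>.\<close>
  moreover have "ext_Phi p \<nu> (b + of_nat n) (c + of_nat n) z =
      z powr (- \<mu> - 1/2 - of_nat n / 2) * exp (z / 2) *
      ext_Whittaker_M p \<nu> (\<kappa> - of_nat n / 2) (\<mu> + of_nat n / 2) z"
    using ext_Whittaker_M_cancel[OF \<open>z \<noteq> 0\<close>,
        of "\<mu> + of_nat n / 2" p \<nu> "\<kappa> - of_nat n / 2"]
    by (simp add: b_def c_def algebra_simps)
  ultimately show ?thesis
    by (simp add: b_def c_def mult.assoc)
qed

end
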